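(* Let $q=2^r$. (a) If either $n\ge3$ is odd (and $q$ arbitrary) or $n=1$ and $q\ge8$, then the map $\mathbb{F}_q\to C(DC^-(n,q))^\perp$, $a\mapsto c^-(a)$, is an $\mathbb{F}_2$-linear isomorphism. (b) If either $n\ge4$ is even (and $q$ arbitrary) or $n=2$ and $q\ge4$, then the map $\mathbb{F}_q\to C(DC^+(n,q))^\perp$, $a\mapsto c^+(a)$, is an $\mathbb{F}_2$-linear isomorphism.
   Context: $q=2^r$; $tr:\mathbb{F}_q\to\mathbb{F}_2$, $tr(x)=x+x^2+\dots+x^{2^{r-1}}$; $\mathrm{Tr}$ is the matrix trace. $Sp(2n,q)=\{w\in GL(2n,\mathbb{F}_q):{}^twJw=J\}$, $J=\begin{pmatrix}0&1_n\\1_n&0\end{pmatrix}$. $P=P(2n,q)$ is the subgroup of all $\begin{pmatrix}A&0\\0&{}^tA^{-1}\end{pmatrix}\begin{pmatrix}1_n&B\\0&1_n\end{pmatrix}$, $A\in GL(n,\mathbb{F}_q)$, $B$ symmetric. $\sigma_s=\begin{pmatrix}0&0&1_s&0\\0&1_{n-s}&0&0\\1_s&0&0&0\\0&0&0&1_{n-s}\end{pmatrix}$ (block sizes $s,n-s,s,n-s$). $DC^-(n,q)=P\sigma_{n-1}P$ ($n$ odd), $DC^+(n,q)=P\sigma_{n-2}P$ ($n$ even). For $D=DC^\mp(n,q)$ with $N=|D|$, fix an ordering $g_1,\dots,g_N$ of $D$ and let $C(D)=\{u\in\mathbb{F}_2^N:\sum_j u_j\,\mathrm{Tr}\,g_j=0\text{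 in }\mathbb{F}_q\}$; $C(D)^\perp$ is its dual with respect to the standard inner product on $\mathbb{F}_2^N$, and $C(D)^\perp=\{c^\mp(a):a\in\mathbb{F}_q\}$ where $c^\mp(a)=(tr(a\,\mathrm{Tr}\,g_1),\dots,tr(a\,\mathrm{Tr}\,g_N))$. *)

theory Defs
  imports "HOL-Library.Z2" "HOL-Library.Cardinality" "Jordan_Normal_Form.VS_Connect"
begin

section \<open>The trace of a finite field of characteristic two\<close>

text \<open>
  The prime field \<open>F\<^sub>2\<close> is the type \<^typ>\<open>bit\<close>; it embeds into every field of
  characteristic two by \<^term>\<open>of_bit\<close>.  In a field with \<open>2^r\<close> elements the sum below lies in
  the image of this embedding (lemma \<open>of_bit_field_trace\<close>), so the description is proper.
\<close>

definition field_trace :: "nat \<Rightarrow> 'a::field \<Rightarrow> bit" where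
  "field_trace r x = (THE b. of_bit b = (\<Sum>i<r. x ^ (2 ^ i)))"

lemma of_bit_field_trace:
  fixes x :: "'a::{field,finite}"
  assumes card: "CARD('a) = 2 ^ r"
  shows "of_bit (field_trace r x) = (\<Sum>i<r. x ^ (2 ^ i))"
proof -
  have power_card: "x ^ (2 ^ r) = x"
  proof (cases "x = 0")
    case True
    then show ?thesis by simp
  next
    case False
    let ?U = "UNIV - {0::'a}"
    have "inj_on ((*) x) ?U"
      using False by (auto simp: inj_on_def)
    moreover have img: "(*) x ` ?U = ?U"
    proof
      show "?U \<subseteq> (*) x ` ?U"
      proof
        fix y assume "y \<in> ?U"
        then have "y = x * (y / x)" "y / x \<in> ?U"
          using False by auto
        then show "y \<in> (*) x ` ?U" by blast
      qed
    qed (use False in auto)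
    ultimately have "\<Prod>?U = (\<Prod>y\<in>?U. x * y)"
      using prod.reindex[of "(*) x" ?U id] by (simp add: o_def)
    also have "\<dots> = x ^ card ?U * \<Prod>?U"
      by (simp add: prod.distrib)
    finally have "x ^ card ?U = 1"
      by simp
    moreover have "Suc (card ?U) = 2 ^ r"
      using card by (simp add: card_Diff_singleton card_gt_0_iff)
    ultimately show ?thesis
      using power_Suc[of x "card ?U"] by (simp only: mult_1_right)
  qed
  have "(\<Sum>y\<in>(UNIV::'a set). y + 1) = (\<Sum>y\<in>(UNIV::'a set). y)"
    by (rule sum.reindex_bij_witness[of _ "\<lambda>y. y - 1" "\<lambda>y. y + 1"]) auto
  then have "(of_nat (2 ^ r) :: 'a) = 0"
    by (simp add: sum.distrib flip: card)
  then have two: "(2::'a) = 0"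
    by simp
  then have sq_add: "(u + v)\<^sup>2 = u\<^sup>2 + v\<^sup>2" for u v :: 'a
    by (simp add: power2_sum)
  let ?S = "\<lambda>r. \<Sum>i<r. x ^ (2 ^ i)"
  have "(?S k)\<^sup>2 + x = ?S k + x ^ (2 ^ k)" for k
  proof (induction k)
    case (Suc k)
    have "(?S (Suc k))\<^sup>2 + x = ((?S k)\<^sup>2 + x) + x ^ (2 ^ Suc k)"
      by (simp add: sq_add power_mult[symmetric] mult.commute add_ac)
    then show ?case
      using Suc by simp
  qed simp
  from this[of r] have "(?S r)\<^sup>2 = ?S r"
    using power_card by simp
  then have "?S r = 0 \<or> ?S r = 1"
    by (simp add: power2_eq_square)
  then have "of_bit 0 = ?S r \<or> of_bit 1 = ?S r"
    by auto
  then obtain b where b: "of_bit b = ?S r"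
    by blast
  have "c = b" if "of_bit c = ?S r" for c
  proof -
    have "of_bit c = (of_bit b :: 'a)"
      using b that by simp
    then show ?thesis
      by (cases b; cases c) simp_all
  qed
  with b have "\<exists>!b. of_bit b = ?S r"
    by blast
  then show ?thesis
    unfolding field_trace_def by (rule theI')
qed


section \<open>Double cosets of the maximal parabolic subgroup\<close>

definition mat_trace :: "'a::comm_monoid_add mat \<Rightarrow> 'a" where
  "mat_trace A = (\<Sum>i<dim_row A. A $$ (i, i))"

text \<open>\<open>A'\<close> is the inverse of \<open>A\<close>, so \<open>A\<close> ranges over \<open>GL(n)\<close>.\<close>

definition parabolic :: "nat \<Rightarrow> 'a::field mat set" where
  "parabolic n =
    {four_block_mat A (0\<^sub>m n n) (0\<^sub>m n n) (transpose_mat A')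
       * four_block_mat (1\<^sub>m n) B (0\<^sub>m n n) (1\<^sub>m n) | A A' B.
     A \<in> carrier_mat n n \<and> A' \<in> carrier_mat n n \<and> inverts_mat A A' \<and> inverts_mat A' A \<and>
     B \<in> carrier_mat n n \<and> transpose_mat B = B}"

text \<open>Only meaningful for \<open>s \<le> n\<close>, since \<open>n - s\<close> is truncated.\<close>

definition sigma_mat :: "nat \<Rightarrow> nat \<Rightarrow> 'a::field mat" where
  "sigma_mat n s = four_block_mat
     (four_block_mat (0\<^sub>m s s) (0\<^sub>m s (n - s)) (0\<^sub>m (n - s) s) (1\<^sub>m (n - s)))
     (four_block_mat (1\<^sub>m s) (0\<^sub>m s (n - s)) (0\<^sub>m (n - s) s) (0\<^sub>m (n - s) (n - s)))
     (four_block_mat (1\<^sub>m s) (0\<^sub>m s (n - s)) (0\<^sub>m (n - s) s) (0\<^sub>m (n - s) (n - s)))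
     (four_block_mat (0\<^sub>m s s) (0\<^sub>m s (n - s)) (0\<^sub>m (n - s) s) (1\<^sub>m (n - s)))"

definition double_coset :: "nat \<Rightarrow> nat \<Rightarrow> 'a::field mat set" where
  "double_coset n s =
    {p * sigma_mat n s * p' | p p'. p \<in> parabolic n \<and> p' \<in> parabolic n}"

definition DC_minus :: "nat \<Rightarrow> 'a::field mat set" where
  "DC_minus n = double_coset n (n - 1)"

definition DC_plus :: "nat \<Rightarrow> 'a::field mat set" where
  "DC_plus n = double_coset n (n - 2)"


section \<open>The binary codes\<close>

text \<open>The list \<open>g\<close> is an enumeration without repetition of the matrices in question.\<close>

definition trace_code :: "'a::field mat list \<Rightarrow> bit vec set" where
  "trace_code g = {u \<in> carrier_vec (length g).
     (\<Sum>j<length g. of_bit (u $ j) * mat_trace (g ! j)) = 0}"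

definition dual_code :: "nat \<Rightarrow> bit vec set \<Rightarrow> bit vec set" where
  "dual_code N C = {v \<in> carrier_vec N. \<forall>u\<in>C. u \<bullet> v = 0}"

definition codeword :: "nat \<Rightarrow> 'a::field mat list \<Rightarrow> 'a \<Rightarrow> bit vec" where
  "codeword r g a = vec (length g) (\<lambda>j. field_trace r (a * mat_trace (g ! j)))"

definition field_F2_space :: "(bit, 'a::field) module" where
  "field_F2_space = \<lparr>carrier = UNIV, mult = (*), one = 1, zero = 0, add = (+),
     smult = (\<lambda>b x. of_bit b * x)\<rparr>"

definition F2_subspace_of_vec :: "nat \<Rightarrow> bit vec set \<Rightarrow> (bit, bit vec) module" where
  "F2_subspace_of_vec N C = (module_vec TYPE(bit) N)\<lparr>carrier := C\<rparr>"

definition F2_linear_iso ::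
    "(bit, 'v) module \<Rightarrow> (bit, 'w) module \<Rightarrow> ('v \<Rightarrow> 'w) \<Rightarrow> bool" where
  "F2_linear_iso V W f \<longleftrightarrow>
     linear_map (class_ring :: bit ring) V W f \<and> bij_betw f (carrier V) (carrier W)"

end

theory Submission
  imports Defs
begin

text \<open>
  A character sum over \<open>F\<^sub>q \<times> F\<^sub>2\<^sup>N\<close> shows that every word of the dual code has the form
  \<open>c(a)\<close>. Injectivity of \<open>a \<mapsto> c(a)\<close> means that no \<open>a \<noteq> 0\<close> satisfies \<open>tr (a * Tr g) = 0\<close> for all \<open>g\<close>
  in the double coset. This is clear if \<open>Tr\<close> is onto \<open>F\<^sub>q\<close>, which is the case for \<open>s \<ge> 1\<close>, and for
  \<open>n = 2\<close>, \<open>s = 0\<close> if \<open>q \<ge> 4\<close>. For \<open>n = 1\<close> the traces are the elements \<open>b + 1 / b\<close>, and \<open>q \<ge> 8\<close> is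
  what a polynomial degree count requires.
\<close>

section \<open>Characteristic two and linearity of the trace\<close>

declare add_bit_eq_xor [simp del] mult_bit_eq_and [simp del]

text \<open>Translation by 1 permutes the field, so \<open>q\<close> times 1 is 0; a field has no
  nilpotents, hence 2 = 0.\<close>

lemma two_eq_0_if_card_power_2:
  assumes "CARD('a::{field,finite}) = 2 ^ r"
  shows "(2::'a) = 0"
proof -
  have "(\<Sum>y\<in>(UNIV::'a set). y + 1) = (\<Sum>y\<in>(UNIV::'a set). y)"
    by (rule sum.reindex_bij_witness[of _ "\<lambda>y. y - 1" "\<lambda>y. y + 1"]) auto
  then have "(of_nat (2 ^ r) :: 'a) = 0"
    by (simp add: sum.distrib flip: assms)
  then show ?thesis by simp
qed

lemma exponent_pos_if_card_power_2:
  assumes "CARD('a::{field,finite}) = 2 ^ r"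
  shows "r > 0"
proof (rule ccontr)
  assume "\<not> r > 0"
  then have "CARD('a) = 1" using assms by simp
  then have "(0::'a) = 1"
    by (metis UNIV_I card_1_singletonE singletonD)
  then show False by simp
qed

lemma add_self_eq_0:
  fixes x :: "'a::ring_1"
  assumes "(2::'a) = 0"
  shows "x + x = 0"
  using assms by (metis mult_2 mult_zero_left)

lemma power_2_power_add:
  fixes x y :: "'a::comm_ring_1"
  assumes "(2::'a) = 0"
  shows "(x + y) ^ (2 ^ i) = x ^ (2 ^ i) + y ^ (2 ^ i)"
proof (induction i)
  case (Suc i)
  have "(x + y) ^ (2 ^ Suc i) = ((x + y) ^ (2 ^ i))\<^sup>2"
    by (simp add: power_mult[symmetric] mult.commute)
  also have "\<dots> = (x ^ (2 ^ i))\<^sup>2 + (y ^ (2 ^ i))\<^sup>2"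
    using assms by (simp add: Suc power2_sum)
  also have "\<dots> = x ^ (2 ^ Suc i) + y ^ (2 ^ Suc i)"
    by (simp add: power_mult[symmetric] mult.commute)
  finally show ?case .
qed simp

lemma of_bit_add:
  assumes "(2::'a::ring_1) = 0"
  shows "of_bit (b + c) = (of_bit b + of_bit c :: 'a)"
  using add_self_eq_0[OF assms, of 1] by (cases b; cases c) auto

lemma of_bit_mult': "of_bit (b * c) = (of_bit b * of_bit c :: 'a::ring_1)"
  by (cases b; cases c) auto

lemma of_bit_inject: "of_bit b = (of_bit c :: 'a::ring_1) \<longleftrightarrow> b = c"
  by (cases b; cases c) auto

text \<open>\<open>of_bit\<close> is injective, so the claim may be checked in the field, where the
  trace is a sum of iterated Frobenius maps.\<close>

lemma field_trace_add:
  fixes x y :: "'a::{field,finite}"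
  assumes "CARD('a) = 2 ^ r"
  shows "field_trace r (x + y) = field_trace r x + field_trace r y"
proof -
  note two = two_eq_0_if_card_power_2[OF assms]
  have "of_bit (field_trace r (x + y)) = (of_bit (field_trace r x + field_trace r y) :: 'a)"
    unfolding of_bit_add[OF two] of_bit_field_trace[OF assms]
    by (simp add: power_2_power_add[OF two] sum.distrib)
  then show ?thesis by (rule iffD1[OF of_bit_inject])
qed

lemma field_trace_0:
  assumes "CARD('a::{field,finite}) = 2 ^ r"
  shows "field_trace r (0::'a) = 0"
  using field_trace_add[OF assms, of 0 0] by simp

lemma field_trace_sum:
  fixes f :: "'b \<Rightarrow> 'a::{field,finite}"
  assumes "CARD('a) = 2 ^ r"
  shows "field_trace r (sum f A) = (\<Sum>x\<in>A. field_trace r (f x))"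
  by (induction A rule: infinite_finite_induct)
    (simp_all add: field_trace_add[OF assms] field_trace_0[OF assms])

lemma field_trace_of_bit_mult:
  fixes x :: "'a::{field,finite}"
  assumes "CARD('a) = 2 ^ r"
  shows "field_trace r (of_bit b * x) = b * field_trace r x"
  by (cases b) (simp_all add: field_trace_0[OF assms])

text \<open>The trace \<open>S\<close> satisfies both \<open>S\<^sup>2 = S\<close>, being a bit, and \<open>S\<^sup>2 - S = x ^ 2 ^ r - x\<close>.\<close>

lemma power_card_eq_self:
  fixes x :: "'a::{field,finite}"
  assumes "CARD('a) = 2 ^ r"
  shows "x ^ (2 ^ r) = x"
proof -
  note two = two_eq_0_if_card_power_2[OF assms]
  let ?S = "\<lambda>k. \<Sum>i<k. x ^ (2 ^ i)"
  have "(?S k)\<^sup>2 + x = ?S k + x ^ (2 ^ k)" for k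
  proof (induction k)
    case (Suc k)
    have "(?S (Suc k))\<^sup>2 + x = ((?S k)\<^sup>2 + x) + x ^ (2 ^ Suc k)"
      using two by (simp add: power2_sum power_mult[symmetric] mult.commute add_ac)
    then show ?case
      using Suc by simp
  qed simp
  moreover have "(?S r)\<^sup>2 = ?S r"
    unfolding of_bit_field_trace[OF assms, symmetric]
    by (cases "field_trace r x") simp_all
  ultimately show ?thesis by (metis add_left_cancel)
qed

text \<open>The trace is a nonzero polynomial of degree at most \<open>q / 2\<close>, so it cannot
  vanish at all \<open>q\<close> elements.\<close>

lemma exists_field_trace_eq_1:
  assumes "CARD('a::{field,finite}) = 2 ^ r"
  obtains x :: "'a::{field,finite}" where "field_trace r x = 1"
proof -
  note r = exponent_pos_if_card_power_2[OF assms]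
  define p :: "'a poly" where "p = (\<Sum>i<r. monom 1 (2 ^ i))"
  \<comment> \<open>Only \<open>i = 0\<close> contributes; \<open>r > 0\<close> ensures that it
    occurs.\<close>
  have "coeff p 1 = (\<Sum>i<r. if i = 0 then 1 else 0)"
    unfolding p_def by (simp add: coeff_sum)
  then have "p \<noteq> 0"
    using r by auto
  have "degree p \<le> 2 ^ (r - 1)"
    unfolding p_def
    by (rule degree_sum_le) (auto intro!: order.trans[OF degree_monom_le] power_increasing)
  also have "\<dots> < CARD('a)"
    using r assms by simp
  finally have "card {x. poly p x = 0} < card (UNIV :: 'a set)"
    using card_poly_roots_bound[OF \<open>p \<noteq> 0\<close>] by simp
  then obtain x where "poly p x \<noteq> 0"
    by (metis (mono_tags, lifting) Collect_cong UNIV_def less_irrefl)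
  then have "of_bit (field_trace r x) \<noteq> (0::'a)"
    unfolding of_bit_field_trace[OF assms] by (simp add: p_def poly_sum poly_monom)
  then have "field_trace r x = 1"
    by (cases "field_trace r x") auto
  then show thesis ..
qed

section \<open>The sign character and its orthogonality relations\<close>

definition bit_sign :: "bit \<Rightarrow> int" where
  "bit_sign b = (if b = 0 then 1 else -1)"

lemma bit_sign_add: "bit_sign (b + c) = bit_sign b * bit_sign c"
  by (cases b; cases c) (simp_all add: bit_sign_def)

lemma bit_sign_sum: "bit_sign (sum f A) = (\<Prod>x\<in>A. bit_sign (f x))"
  by (induction A rule: infinite_finite_induct) (simp_all add: bit_sign_add bit_sign_def [of 0])

text \<open>For \<open>t \<noteq> 0\<close>, shifting \<open>a\<close> by \<open>x / t\<close> with
  \<open>tr x = 1\<close> flips every sign, so the sum is its own negative.\<close>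

lemma sum_bit_sign_field_trace:
  fixes t :: "'a::{field,finite}"
  assumes "CARD('a) = 2 ^ r"
  shows "(\<Sum>a\<in>UNIV. bit_sign (field_trace r (a * t))) = (if t = 0 then int CARD('a) else 0)"
proof (cases "t = 0")
  case True
  then show ?thesis by (simp add: field_trace_0[OF assms] bit_sign_def)
next
  case False
  obtain x :: 'a where x: "field_trace r x = 1"
    using exists_field_trace_eq_1[OF assms] .
  have "(\<Sum>a\<in>UNIV. bit_sign (field_trace r (a * t)))
      = (\<Sum>a\<in>UNIV. bit_sign (field_trace r ((a + x / t) * t)))"
    by (rule sum.reindex_bij_witness[of _ "\<lambda>a. a + x / t" "\<lambda>a. a - x / t"]) auto
  also have "\<dots> = - (\<Sum>a\<in>UNIV. bit_sign (field_trace r (a * t)))"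
    using False bit_sign_def[of 1]
    by (simp add: distrib_right field_trace_add[OF assms] x bit_sign_add sum_negf)
  finally show ?thesis using False by simp
qed

text \<open>
  Summing \<open>bit_sign\<close> of \<open>u \<bullet> v + tr (a * (\<Sum>j. u j * t j))\<close> over all \<open>a\<close> and all \<open>u\<close> gives
  \<open>q * card C > 0\<close> if \<open>v\<close> is orthogonal to \<open>C\<close>; on the other hand the sum over \<open>u\<close> alone
  vanishes unless \<open>v\<close> is the codeword of \<open>a\<close>.
\<close>

lemma in_dual_code_imp_codeword:
  fixes g :: "'a::{field,finite} mat list"
  assumes card: "CARD('a) = 2 ^ r"
    and v: "v \<in> dual_code (length g) (trace_code g)"
  obtains a where "v = codeword r g a"
proof -
  define N where "N = length g"
  define t where "t j = mat_trace (g ! j)" for j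
  have dim: "dim_vec v = N"
    using v by (auto simp: dual_code_def N_def)
  \<comment> \<open>A set \<open>X\<close> stands for the word with support \<open>X\<close>; the
    condition on \<open>t\<close> puts this word into the code.\<close>
  have orth: "(\<Sum>j\<in>X. v $ j) = 0" if X: "X \<subseteq> {..<N}" and 0: "(\<Sum>j\<in>X. t j) = 0" for X
  proof -
    define u where "u = vec N (\<lambda>j. of_bool (j \<in> X) :: bit)"
    have "(\<Sum>j<N. of_bit (u $ j) * t j) = (\<Sum>j<N. if j \<in> X then t j else 0)"
      by (rule sum.cong) (auto simp: u_def)
    also have "\<dots> = (\<Sum>j\<in>X. t j)"
      using X by (simp add: sum.If_cases Int_absorb1)
    finally have "u \<in> trace_code g"
      using 0 unfolding trace_code_def N_def t_def by (simp only: mem_Collect_eq) (simp add: u_def N_def)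
    then have "u \<bullet> v = 0"
      using v by (auto simp: dual_code_def)
    moreover have "u \<bullet> v = (\<Sum>j\<in>{0..<N}. if j \<in> X then v $ j else 0)"
      unfolding scalar_prod_def dim by (rule sum.cong) (auto simp: u_def)
    moreover have "\<dots> = (\<Sum>j\<in>X. v $ j)"
      using X by (simp add: sum.If_cases Int_absorb1 lessThan_atLeast0)
    ultimately show ?thesis by simp
  qed
  \<comment> \<open>The integer \<open>f a j + 1\<close> is 2 or 0, and 0 exactly when
    \<open>v\<close> and the codeword of \<open>a\<close> differ at \<open>j\<close>.\<close>
  define f where "f a j = bit_sign (v $ j + field_trace r (a * t j))" for a j
  have "(\<Sum>a\<in>UNIV. \<Prod>j<N. f a j + 1) = (\<Sum>a\<in>UNIV. \<Sum>X\<in>Pow {..<N}. \<Prod>j\<in>X. f a j)"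
    by (simp add: prod_add)
  also have "\<dots> = (\<Sum>X\<in>Pow {..<N}. \<Sum>a\<in>UNIV. \<Prod>j\<in>X. f a j)"
    by (rule sum.swap)
  also have "\<dots> = (\<Sum>X\<in>Pow {..<N}. bit_sign (\<Sum>j\<in>X. v $ j) *
      (\<Sum>a\<in>UNIV. bit_sign (field_trace r (a * (\<Sum>j\<in>X. t j)))))"
    by (simp add: f_def bit_sign_sum bit_sign_add field_trace_sum[OF card] prod.distrib
        sum_distrib_left)
  also have "\<dots> = (\<Sum>X\<in>Pow {..<N}. if (\<Sum>j\<in>X. t j) = 0 then int CARD('a) else 0)"
    by (rule sum.cong) (auto simp: sum_bit_sign_field_trace[OF card] orth bit_sign_def [of 0])
  \<comment> \<open>All summands are nonnegative, and \<open>X = {}\<close> alone contributes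
    \<open>q\<close>.\<close>
  also have "\<dots> \<ge> (\<Sum>X\<in>{{}}. if (\<Sum>j\<in>X. t j) = 0 then int CARD('a) else 0)"
    by (rule sum_mono2) auto
  finally have "(\<Sum>a\<in>UNIV. \<Prod>j<N. f a j + 1) > 0"
    by (simp add: card less_le_trans[OF zero_less_power[of 2 r]])
  then obtain a where a: "(\<Prod>j<N. f a j + 1) \<noteq> 0"
    by (metis (mono_tags, lifting) less_irrefl sum.neutral)
  have "v = codeword r g a"
  proof (rule eq_vecI)
    fix j assume "j < dim_vec (codeword r g a)"
    then have j: "j < N"
      by (simp add: codeword_def N_def)
    then have "f a j + 1 \<noteq> 0"
      using a by auto
    then have "v $ j + field_trace r (a * t j) = 0"
      by (auto simp: f_def bit_sign_def split: if_splits)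
    then have "v $ j = field_trace r (a * t j)"
      by (cases "v $ j"; cases "field_trace r (a * t j)") auto
    then show "v $ j = codeword r g a $ j"
      using j by (simp add: codeword_def N_def t_def)
  qed (simp add: codeword_def dim N_def)
  then show thesis ..
qed

text \<open>By linearity of the trace over the bits, pairing with \<open>u\<close> moves inside it
  and produces \<open>tr (a * 0)\<close>.\<close>

lemma codeword_in_dual_code:
  fixes g :: "'a::{field,finite} mat list"
  assumes card: "CARD('a) = 2 ^ r"
  shows "codeword r g a \<in> dual_code (length g) (trace_code g)"
proof -
  have "u \<bullet> codeword r g a = 0" if u: "u \<in> trace_code g" for u
  proof -
    have "u \<bullet> codeword r g a
        = (\<Sum>j<length g. field_trace r (of_bit (u $ j) * (a * mat_trace (g ! j))))"
      unfolding field_trace_of_bit_mult[OF card]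
      by (simp add: scalar_prod_def codeword_def lessThan_atLeast0 mult.assoc)
    also have "\<dots> = field_trace r (a * (\<Sum>j<length g. of_bit (u $ j) * mat_trace (g ! j)))"
      by (simp add: field_trace_sum[OF card] sum_distrib_left mult_ac del: sum_of_bool_mult_eq sum_mult_of_bool_eq)
    finally show ?thesis
      using u by (simp add: trace_code_def field_trace_0[OF card])
  qed
  then show ?thesis
    by (simp add: dual_code_def codeword_def)
qed

section \<open>The code map between vector spaces over the bits\<close>

lemma vectorspace_field_F2_space:
  assumes "(2::'a::field) = 0"
  shows "vectorspace (class_ring :: bit ring) (field_F2_space :: (bit, 'a) module)"
proof -
  have "abelian_group (field_F2_space :: (bit, 'a) module)"
    by (rule abelian_groupI) (auto simp: field_F2_space_def add_ac intro: exI[of _ "- _"])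
  then have "module (class_ring :: bit ring) (field_F2_space :: (bit, 'a) module)"
    by (intro moduleI)
      (auto simp: field_F2_space_def algebra_simps assms of_bit_add[OF assms] of_bit_mult'
        intro: class_cring.is_cring)
  then show ?thesis
    by (simp add: vectorspace_def class_field)
qed

lemma vectorspace_dual_code:
  assumes "C \<subseteq> carrier_vec N"
  shows "vectorspace (class_ring :: bit ring) (F2_subspace_of_vec N (dual_code N C))"
proof -
  interpret vec_space "TYPE(bit)" N .
  have "LinearCombinations.submodule class_ring (dual_code N C) V"
    unfolding LinearCombinations.submodule_def
    using assms vec_module[where 'a = bit and n = N]
    by (auto simp: dual_code_def module_vec_simps scalar_prod_add_distrib[of _ N]
        scalar_prod_smult_distrib[of _ N] subset_iff)
  then have "subspace class_ring (dual_code N C) V"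
    by (simp add: subspace_def vec_vs)
  then show ?thesis
    unfolding F2_subspace_of_vec_def by (rule subspace_is_vs)
qed

lemma trace_code_subset: "trace_code g \<subseteq> carrier_vec (length g)"
  by (auto simp: trace_code_def)

text \<open>Linearity and surjectivity hold for every list \<open>g\<close>; \<open>nondeg\<close>
  says exactly that the kernel is trivial.\<close>

lemma codeword_iso:
  fixes g :: "'a::{field,finite} mat list"
  assumes card: "CARD('a) = 2 ^ r"
    and nondeg: "\<And>a. a \<noteq> 0 \<Longrightarrow> \<exists>m\<in>set g. field_trace r (a * mat_trace m) \<noteq> 0"
  shows "F2_linear_iso field_F2_space
    (F2_subspace_of_vec (length g) (dual_code (length g) (trace_code g))) (codeword r g)"
proof -
  let ?D = "dual_code (length g) (trace_code g)"
  have add: "codeword r g (a + b) = codeword r g a + codeword r g b" for a b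
    by (rule eq_vecI) (simp_all add: codeword_def distrib_right field_trace_add[OF card])
  have smult: "codeword r g (of_bit c * a) = c \<cdot>\<^sub>v codeword r g a" for c a
    by (rule eq_vecI) (simp_all add: codeword_def mult.assoc field_trace_0[OF card]
        field_trace_of_bit_mult[OF card])
  have smult_0: "0 \<cdot>\<^sub>v codeword r g a = codeword r g 0" for a
    using smult[of 0 a] by simp
  have "linear_map (class_ring :: bit ring) field_F2_space (F2_subspace_of_vec (length g) ?D)
      (codeword r g)"
    using vectorspace_field_F2_space[OF two_eq_0_if_card_power_2[OF card]]
      vectorspace_dual_code[of "trace_code g" "length g"] codeword_in_dual_code[OF card, of g]
    unfolding linear_map_def mod_hom_def mod_hom_axioms_def vectorspace_def
      LinearCombinations.module_hom_def
    by (auto simp: field_F2_space_def F2_subspace_of_vec_def module_vec_simps add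
        smult smult_0 trace_code_subset)
  moreover have "inj (codeword r g)"
  proof (rule injI)
    fix a b assume eq: "codeword r g a = codeword r g b"
    have "field_trace r ((a - b) * mat_trace m) = 0" if m: "m \<in> set g" for m
    proof -
      obtain j where j: "j < length g" "m = g ! j"
        using m by (metis in_set_conv_nth)
      have "codeword r g a $ j = codeword r g (a - b + b) $ j" by simp
      also have "\<dots> = codeword r g (a - b) $ j + codeword r g b $ j"
        unfolding add using j by (simp add: codeword_def)
      finally have "codeword r g (a - b) $ j = 0"
        unfolding eq by simp
      then show ?thesis
        using j by (simp add: codeword_def)
    qed
    then show "a = b"
      using nondeg[of "a - b"] by auto
  qed
  moreover have "range (codeword r g) = ?D"
    using codeword_in_dual_code[OF card] in_dual_code_imp_codeword[OF card] by blast
  ultimately show ?thesis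
    by (simp add: F2_linear_iso_def bij_betw_def field_F2_space_def F2_subspace_of_vec_def)
qed

section \<open>Traces of multiples of \<open>b + 1 / b\<close>\<close>

text \<open>
  If \<open>tr (a * b) = tr (a / b)\<close> for all \<open>b \<noteq> 0\<close>, then multiplying this equation by \<open>b ^ (q / 2)\<close> and
  using \<open>b ^ q = b\<close> gives a polynomial equation in \<open>b\<close> of degree at most \<open>3 * q / 4\<close>, with constant
  coefficient \<open>a ^ (q / 2) \<noteq> 0\<close> and with \<open>q - 1\<close> solutions.
\<close>

lemma exists_field_trace_add_inverse_neq_0:
  fixes a :: "'a::{field,finite}"
  assumes card: "CARD('a) = 2 ^ r" "CARD('a) \<ge> 8" and a: "a \<noteq> 0"
  obtains b where "b \<noteq> 0" "field_trace r (a * (b + inverse b)) \<noteq> 0"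
proof (rule ccontr)
  note two = two_eq_0_if_card_power_2[OF card(1)]
  assume "\<not> thesis"
  with that have zero: "field_trace r (a * (b + inverse b)) = 0" if "b \<noteq> 0" for b
    using \<open>b \<noteq> 0\<close> by blast
  have "(2::nat) ^ 3 \<le> 2 ^ r"
    using card by simp
  then have "3 \<le> r"
    by (simp only: power_increasing_iff)
  then obtain m where r: "r = Suc (Suc m)" and m: "m \<ge> 1"
    by (metis Suc_le_D Suc_le_mono numeral_3_eq_3 One_nat_def)
  \<comment> \<open>Here \<open>k = q / 4\<close> and \<open>h = q / 2\<close>;
    \<open>q \<ge> 8\<close> gives \<open>k \<ge> 2\<close>, on which the final count
    depends.\<close>
  define k h :: nat where "k = 2 ^ m" and "h = 2 ^ Suc m"
  have k: "k \<ge> 2" "h = 2 * k" "2 ^ r = 2 * h"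
    using m power_increasing[of 1 m "2::nat"] by (auto simp: k_def h_def r)
  have pow_le: "2 ^ i \<le> k" if "i < Suc m" for i
    using that by (auto simp: k_def intro!: power_increasing)
  \<comment> \<open>The summand \<open>i = r - 1\<close> of the trace is split off: its exponents
    \<open>h + h\<close> and \<open>h - h\<close> become 1 and 0 by
    \<open>b ^ q = b\<close>.\<close>
  define p where "p = monom (a ^ h) 1 + monom (a ^ h) 0
    + (\<Sum>i<Suc m. monom (a ^ 2 ^ i) (h + 2 ^ i) + monom (a ^ 2 ^ i) (h - 2 ^ i))"
  have root: "poly p b = 0" if b: "b \<noteq> 0" for b
  proof -
    have pow_term: "b ^ h * (a * (b + inverse b)) ^ 2 ^ i
        = a ^ 2 ^ i * b ^ (h + 2 ^ i) + a ^ 2 ^ i * b ^ (h - 2 ^ i)" if "2 ^ i \<le> h" for i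
      using b that
      by (simp add: power_mult_distrib power_2_power_add[OF two] power_add power_diff
          power_inverse field_simps)
    have "b ^ (h + h) = b"
      using power_card_eq_self[OF card(1), of b] k by (simp add: mult_2)
    then have last: "b ^ h * (a * (b + inverse b)) ^ 2 ^ Suc m = a ^ h * b + a ^ h"
      using pow_term[of "Suc m"] by (simp add: h_def)
    have "poly p b = a ^ h * b + a ^ h
        + (\<Sum>i<Suc m. a ^ 2 ^ i * b ^ (h + 2 ^ i) + a ^ 2 ^ i * b ^ (h - 2 ^ i))"
      by (simp only: p_def poly_add poly_sum poly_monom power_one_right power_0 mult_1_right)
    also have "(\<Sum>i<Suc m. a ^ 2 ^ i * b ^ (h + 2 ^ i) + a ^ 2 ^ i * b ^ (h - 2 ^ i))
        = (\<Sum>i<Suc m. b ^ h * (a * (b + inverse b)) ^ 2 ^ i)"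
    proof (intro sum.cong refl pow_term[symmetric])
      fix i assume "i \<in> {..<Suc m}"
      then show "2 ^ i \<le> h" using pow_le[of i] k by simp
    qed
    also have "a ^ h * b + a ^ h + \<dots> = b ^ h * (\<Sum>i<r. (a * (b + inverse b)) ^ 2 ^ i)"
      unfolding r sum.lessThan_Suc[of _ "Suc m"] distrib_left[of "b ^ h"] last sum_distrib_left
      by (simp only: add.commute)
    also have "\<dots> = b ^ h * of_bit (field_trace r (a * (b + inverse b)))"
      by (simp only: of_bit_field_trace[OF card(1)])
    finally show ?thesis
      using zero[OF b] by simp
  qed
  have "poly (monom (a ^ 2 ^ i) (h + 2 ^ i) + monom (a ^ 2 ^ i) (h - 2 ^ i)) 0 = 0"
    if "i < Suc m" for i
  proof -
    \<comment> \<open>Keeps the truncated exponent \<open>h - 2 ^ i\<close> positive, so that the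
      term vanishes at 0.\<close>
    have "2 ^ i \<noteq> h"
      using pow_le[OF that] k by linarith
    with pow_le[OF that] k(2) have "0 < h - 2 ^ i"
      by linarith
    then show ?thesis
      by (simp add: poly_monom power_0_left)
  qed
  then have "poly p 0 = a ^ h"
    unfolding p_def poly_add poly_sum
    by (subst sum.neutral) (auto simp: poly_monom)
  then have "p \<noteq> 0"
    using a by auto
  have deg: "degree (monom (c :: 'a) j) \<le> h + k" if "j \<le> h + k" for c j
    using degree_monom_le that by (rule order.trans)
  have "degree p \<le> h + k"
    unfolding p_def
  proof (intro degree_add_le degree_sum_le deg)
    fix i assume "i \<in> {..<Suc m}"
    then show "h + 2 ^ i \<le> h + k" "h - 2 ^ i \<le> h + k"
      using pow_le[of i] by auto
  qed (use k in auto)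
  moreover have "card (UNIV - {0::'a}) \<le> card {b. poly p b = 0}"
    using root by (intro card_mono) auto
  moreover have "card {b. poly p b = 0} \<le> degree p"
    using \<open>p \<noteq> 0\<close> by (rule card_poly_roots_bound)
  moreover have "card (UNIV - {0::'a}) = 2 * h - 1"
    using card(1) k by (simp add: card_Diff_singleton)
  \<comment> \<open>At least \<open>4 * k - 1\<close> roots face a degree of at most
    \<open>3 * k\<close>.\<close>
  ultimately show False
    using k by linarith
qed

section \<open>Traces attained on the double cosets\<close>

lemma mat_trace_four_block_mat:
  assumes "A \<in> carrier_mat n n" "D \<in> carrier_mat m m"
  shows "mat_trace (four_block_mat A B C D) = mat_trace A + mat_trace D"
proof -
  have "mat_trace (four_block_mat A B C D)
      = (\<Sum>i<n + m. if i < n then A $$ (i, i) else D $$ (i - n, i - n))"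
    using assms unfolding mat_trace_def by (intro sum.cong) auto
  also have "\<dots> = (\<Sum>i<n. A $$ (i, i)) + (\<Sum>i<m. D $$ (i, i))"
    by (simp add: lessThan_atLeast0 sum.atLeastLessThan_concat[symmetric, of 0 n "n+m"]
        sum.atLeastLessThan_shift_0[of _ n "n+m"])
  finally show ?thesis
    using assms by (simp add: mat_trace_def)
qed

lemma parabolic_carrier: "p \<in> parabolic n \<Longrightarrow> p \<in> carrier_mat (n + n) (n + n)"
  by (auto simp: parabolic_def)

lemma one_mat_in_parabolic: "1\<^sub>m (n + n) \<in> parabolic n"
proof -
  have one: "four_block_mat (1\<^sub>m n) (0\<^sub>m n n) (0\<^sub>m n n) (1\<^sub>m n) = (1\<^sub>m (n + n) :: 'a mat)"
    by (rule eq_matI) auto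
  show ?thesis
    unfolding parabolic_def
    by (intro CollectI exI[of _ "1\<^sub>m n"] exI[of _ "0\<^sub>m n n"])
      (auto simp: one inverts_mat_def transpose_one)
qed

text \<open>The two factors in \<open>parabolic\<close> are multiplied out, which makes the diagonal
  blocks visible.\<close>

lemma four_block_in_parabolic:
  assumes "A \<in> carrier_mat n n" "A' \<in> carrier_mat n n" "A * A' = 1\<^sub>m n" "A' * A = 1\<^sub>m n"
    "B \<in> carrier_mat n n" "transpose_mat B = B"
  shows "four_block_mat A (A * B) (0\<^sub>m n n) (transpose_mat A') \<in> parabolic n"
proof -
  have "four_block_mat A (0\<^sub>m n n) (0\<^sub>m n n) (transpose_mat A')
      * four_block_mat (1\<^sub>m n) B (0\<^sub>m n n) (1\<^sub>m n)
    = four_block_mat A (A * B) (0\<^sub>m n n) (transpose_mat A')"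
    using assms by (subst mult_four_block_mat[of _ n n _ n _ n _ _ n _ n]) auto
  then show ?thesis
    using assms unfolding parabolic_def inverts_mat_def
    by (intro CollectI exI[of _ A] exI[of _ A'] exI[of _ B]) auto
qed

lemma sigma_mat_carrier: "s \<le> n \<Longrightarrow> sigma_mat n s \<in> carrier_mat (n + n) (n + n)"
  by (rule carrier_matI) (simp_all add: sigma_mat_def)

lemma parabolic_mult_sigma_mat_in_double_coset:
  assumes "p \<in> parabolic n" "s \<le> n"
  shows "p * sigma_mat n s \<in> double_coset n s"
proof -
  have "p * sigma_mat n s = p * sigma_mat n s * 1\<^sub>m (n + n)"
    using parabolic_carrier[OF assms(1)] sigma_mat_carrier[OF assms(2)]
    by (metis mult_carrier_mat right_mult_one_mat)
  then show ?thesis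
    using assms(1) one_mat_in_parabolic unfolding double_coset_def by blast
qed

text \<open>The value \<open>s = 0\<close> occurs for \<open>DC_minus 1\<close> and
  \<open>DC_plus 2\<close>, where the double coset is the parabolic group itself.\<close>

lemma sigma_mat_0: "sigma_mat n 0 = 1\<^sub>m (n + n)"
  by (rule eq_matI) (auto simp: sigma_mat_def)

text \<open>With \<open>B = 0\<close> the diagonal blocks are \<open>A\<close> and the transpose of
  its inverse, and transposing keeps the trace.\<close>

lemma trace_in_double_coset_0:
  assumes "A \<in> carrier_mat n n" "A' \<in> carrier_mat n n" "A * A' = 1\<^sub>m n" "A' * A = 1\<^sub>m n"
  shows "mat_trace A + mat_trace A' \<in> mat_trace ` double_coset n 0"
proof -
  let ?p = "four_block_mat A (A * 0\<^sub>m n n) (0\<^sub>m n n) (transpose_mat A')"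
  have p: "?p \<in> parabolic n"
    using assms by (intro four_block_in_parabolic) auto
  have "mat_trace ?p = mat_trace A + mat_trace A'"
    using assms by (subst mat_trace_four_block_mat[of _ n _ n]) (auto simp: mat_trace_def)
  moreover have "?p \<in> double_coset n 0"
    using parabolic_mult_sigma_mat_in_double_coset[OF p, of 0] parabolic_carrier[OF p]
    by (simp add: sigma_mat_0 right_mult_one_mat)
  ultimately show ?thesis by (metis imageI)
qed

text \<open>
  Writing \<open>E\<close>, \<open>F\<close> for the diagonal and off-diagonal blocks of \<open>\<sigma>\<^sub>s\<close>, the product of \<open>(1, B; 0, 1)\<close>
  with \<open>\<sigma>\<^sub>s\<close> has trace \<open>2 * Tr E + Tr (B * F)\<close>; let \<open>t\<close> be the only nonzero entry of \<open>B\<close>, in the corner \<open>(0, 0)\<close>.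
\<close>

lemma trace_in_double_coset:
  fixes t :: "'a::field"
  assumes two: "(2::'a) = 0" and s: "0 < s" "s \<le> n"
  shows "t \<in> mat_trace ` double_coset n s"
proof -
  define B where "B = mat n n (\<lambda>(i, j). if i = 0 \<and> j = 0 then t else 0)"
  define E :: "'a mat" where
    "E = four_block_mat (0\<^sub>m s s) (0\<^sub>m s (n - s)) (0\<^sub>m (n - s) s) (1\<^sub>m (n - s))"
  define F :: "'a mat" where
    "F = four_block_mat (1\<^sub>m s) (0\<^sub>m s (n - s)) (0\<^sub>m (n - s) s) (0\<^sub>m (n - s) (n - s))"
  let ?p = "four_block_mat (1\<^sub>m n) (1\<^sub>m n * B) (0\<^sub>m n n) (transpose_mat (1\<^sub>m n))"
  have B: "B \<in> carrier_mat n n"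
    by (simp add: B_def)
  have carr: "E \<in> carrier_mat n n" "F \<in> carrier_mat n n"
    using s by (auto intro!: carrier_matI simp: E_def F_def)
  have "transpose_mat B = B"
    by (rule eq_matI) (auto simp: B_def)
  then have "?p \<in> parabolic n"
    using B by (intro four_block_in_parabolic) auto
  then have "?p * sigma_mat n s \<in> double_coset n s"
    using s by (intro parabolic_mult_sigma_mat_in_double_coset)
  moreover have "?p * sigma_mat n s = four_block_mat (E + B * F) (F + B * E) F E"
    unfolding sigma_mat_def E_def[symmetric] F_def[symmetric]
    using carr B by (subst mult_four_block_mat[of _ n n _ n _ n _ _ n _ n]) (auto simp: transpose_one)
  moreover have "mat_trace (four_block_mat (E + B * F) (F + B * E) F E) = t"
  proof -
    have BF: "(B * F) $$ (i, i) = (if i = 0 then t else 0)" if "i < n" for i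
    proof -
      have "(B * F) $$ (i, i) = (\<Sum>k\<in>{0..<n}. B $$ (i, k) * F $$ (k, i))"
        using that B carr by (auto simp: scalar_prod_def intro!: sum.cong)
      \<comment> \<open>\<open>B\<close> leaves only \<open>i = k = 0\<close>, and \<open>F\<close>
        has entry 1 there because \<open>s > 0\<close>.\<close>
      also have "\<dots> = (\<Sum>k\<in>{0..<n}. if k = 0 then (if i = 0 then t else 0) else 0)"
        using that s by (intro sum.cong) (auto simp: B_def F_def)
      finally show ?thesis using that by simp
    qed
    have "mat_trace (E + B * F) = mat_trace E + (\<Sum>i<n. if i = 0 then t else 0)"
      using B carr by (simp add: mat_trace_def sum.distrib BF del: index_mult_mat(1) sum.delta)
    moreover have "(\<Sum>i<n. if i = 0 then t else 0) = t"
      using s by simp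
    ultimately show ?thesis
      using B carr add_self_eq_0[OF two, of "mat_trace E"]
      by (subst mat_trace_four_block_mat[of _ n _ n]) (auto simp: algebra_simps)
  qed
  ultimately show ?thesis by (metis imageI)
qed

text \<open>
  The matrix \<open>(x, d; 1, 0)\<close> has trace \<open>x\<close> and determinant \<open>d\<close> (the characteristic being two), so the
  trace of its inverse is \<open>x / d\<close>.
\<close>

lemma trace_in_double_coset_2_0:
  fixes t :: "'a::{field,finite}"
  assumes two: "(2::'a) = 0" and card: "CARD('a) \<ge> 4"
  shows "t \<in> mat_trace ` double_coset 2 0"
proof -
  have "\<exists>d::'a. d \<notin> {0, 1}"
  proof (rule ccontr)
    assume "\<not> ?thesis"
    then have "UNIV = {0, 1 :: 'a}" by auto
    then have "CARD('a) = 2" by (metis card_2_iff zero_neq_one)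
    then show False using card by simp
  qed
  then obtain d :: 'a where d: "d \<noteq> 0" "d \<noteq> 1" by auto
  have minus: "- x = x" for x :: 'a
    using add_self_eq_0[OF two, of x] by (simp add: eq_neg_iff_add_eq_0[symmetric])
  have d1: "1 + d \<noteq> 0"
    using d minus by (metis add_eq_0_iff)
  \<comment> \<open>Solves \<open>x + x / d = t\<close>, using \<open>1 + d \<noteq> 0\<close>; this
    is why \<open>d\<close> was chosen different from 1.\<close>
  define x where "x = t * d / (1 + d)"
  define A where "A = mat 2 2
    (\<lambda>(i, j). if i = 0 then (if j = 0 then x else d) else (if j = 0 then 1 else 0))"
  \<comment> \<open>The adjugate of \<open>A\<close> over its determinant; signs disappear in
    characteristic two.\<close>
  define A' where "A' = mat 2 2
    (\<lambda>(i, j). if i = 0 then (if j = 0 then 0 else 1) else (if j = 0 then 1 / d else x / d))"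
  have less2: "i < 2 \<longleftrightarrow> i = 0 \<or> i = 1" for i :: nat by auto
  have A: "A \<in> carrier_mat 2 2" "A' \<in> carrier_mat 2 2"
    by (auto simp: A_def A'_def)
  have "A * A' = 1\<^sub>m 2"
    by (rule eq_matI)
      (use d in \<open>auto simp: A_def A'_def scalar_prod_def less2 numeral_2_eq_2 add_self_eq_0[OF two]\<close>)
  moreover have "A' * A = 1\<^sub>m 2"
    by (rule eq_matI)
      (use d in \<open>auto simp: A_def A'_def scalar_prod_def less2 numeral_2_eq_2 add_self_eq_0[OF two]
        add_divide_distrib[symmetric]\<close>)
  ultimately have "mat_trace A + mat_trace A' \<in> mat_trace ` double_coset 2 0"
    using A by (intro trace_in_double_coset_0)
  also have "mat_trace A + mat_trace A' = x + x / d"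
    by (simp add: A_def A'_def mat_trace_def numeral_2_eq_2)
  also have "\<dots> = t"
    using d d1 by (simp add: x_def divide_simps) (simp add: algebra_simps)
  finally show ?thesis .
qed

lemma trace_in_double_coset_1_0:
  fixes b :: "'a::field"
  assumes "b \<noteq> 0"
  shows "b + inverse b \<in> mat_trace ` double_coset 1 0"
proof -
  have "mat_trace (mat 1 1 (\<lambda>_. b)) + mat_trace (mat 1 1 (\<lambda>_. inverse b))
      \<in> mat_trace ` double_coset 1 0"
    by (rule trace_in_double_coset_0; (intro eq_matI)?) (use assms in \<open>auto simp: scalar_prod_def\<close>)
  then show ?thesis by (simp add: mat_trace_def)
qed

theorem theorem13:
  fixes r n :: nat
  assumes "CARD('a::{field,finite}) = 2 ^ r"
  shows
    "((odd n \<and> n \<ge> 3) \<or> (n = 1 \<and> CARD('a) \<ge> 8) \<longrightarrow>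
       (\<forall>g :: 'a mat list. distinct g \<and> set g = DC_minus n \<longrightarrow>
          F2_linear_iso field_F2_space
            (F2_subspace_of_vec (length g) (dual_code (length g) (trace_code g)))
            (codeword r g)))
     \<and>
     ((even n \<and> n \<ge> 4) \<or> (n = 2 \<and> CARD('a) \<ge> 4) \<longrightarrow>
       (\<forall>g :: 'a mat list. distinct g \<and> set g = DC_plus n \<longrightarrow>
          F2_linear_iso field_F2_space
            (F2_subspace_of_vec (length g) (dual_code (length g) (trace_code g)))
            (codeword r g)))"
  proof -
  note two = two_eq_0_if_card_power_2[OF assms]
  obtain x :: 'a where x: "field_trace r x = 1"
    using exists_field_trace_eq_1[OF assms] .
  \<comment> \<open>If \<open>Tr\<close> is onto, a matrix of trace \<open>x / a\<close> turns
    \<open>tr (a * Tr g)\<close> into \<open>tr x = 1\<close>.\<close>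
  have iso: "F2_linear_iso field_F2_space
      (F2_subspace_of_vec (length g) (dual_code (length g) (trace_code g))) (codeword r g)"
    if surj: "\<And>t. t \<in> mat_trace ` set g" for g :: "'a mat list"
  proof (rule codeword_iso[OF assms])
    fix a :: 'a assume "a \<noteq> 0"
    then have "field_trace r (a * (x / a)) \<noteq> 0"
      using x by simp
    with surj[of "x / a"] show "\<exists>m\<in>set g. field_trace r (a * mat_trace m) \<noteq> 0"
      by (metis imageE)
  qed
  \<comment> \<open>Since \<open>b\<close> and \<open>1 / b\<close> give the same
    \<open>b + 1 / b\<close>, \<open>Tr\<close> is not onto for \<open>n = 1\<close>, and the root
    count replaces surjectivity.\<close>
  have iso1: "F2_linear_iso field_F2_space
      (F2_subspace_of_vec (length g) (dual_code (length g) (trace_code g))) (codeword r g)"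
    if g: "set g = DC_minus 1" and card: "CARD('a) \<ge> 8" for g :: "'a mat list"
  proof (rule codeword_iso[OF assms])
    fix a :: 'a assume "a \<noteq> 0"
    then obtain b where b: "b \<noteq> 0" "field_trace r (a * (b + inverse b)) \<noteq> 0"
      by (rule exists_field_trace_add_inverse_neq_0[OF assms card])
    from trace_in_double_coset_1_0[OF b(1)] obtain m
      where "m \<in> set g" "mat_trace m = b + inverse b"
      by (auto simp: g DC_minus_def)
    with b(2) show "\<exists>m\<in>set g. field_trace r (a * mat_trace m) \<noteq> 0"
      by metis
  qed
  show ?thesis
  proof (intro conjI impI allI; elim conjE)
    fix g :: "'a mat list"
    assume n: "(odd n \<and> n \<ge> 3) \<or> (n = 1 \<and> CARD('a) \<ge> 8)" and g: "set g = DC_minus n"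
    show "F2_linear_iso field_F2_space
      (F2_subspace_of_vec (length g) (dual_code (length g) (trace_code g))) (codeword r g)"
    proof (cases "n = 1")
      case True
      with n g show ?thesis by (intro iso1) auto
    next
      case False
      with n have "0 < n - 1" "n - 1 \<le> n" by auto
      then show ?thesis
        by (intro iso) (simp add: g DC_minus_def trace_in_double_coset[OF two])
    qed
  next
    fix g :: "'a mat list"
    assume n: "(even n \<and> n \<ge> 4) \<or> (n = 2 \<and> CARD('a) \<ge> 4)" and g: "set g = DC_plus n"
    have "t \<in> mat_trace ` set g" for t
    proof (cases "n = 2")
      case True
      with n have "t \<in> mat_trace ` double_coset 2 0"
        by (intro trace_in_double_coset_2_0[OF two]) auto
      with True show ?thesis
        by (simp add: g DC_plus_def)
    next
      case False
      with n have "0 < n - 2" "n - 2 \<le> n" by auto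
      then show ?thesis
        unfolding g DC_plus_def by (rule trace_in_double_coset[OF two])
    qed
    then show "F2_linear_iso field_F2_space
      (F2_subspace_of_vec (length g) (dual_code (length g) (trace_code g))) (codeword r g)"
      by (rule iso)
  qed
qed

end
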